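(* Let $n_1,n_2,q\ge 2$ be integers and $n=n_1+n_2-1$. Then $$S_2(q,n)\ge \big(\chi(q,n_1)-1\big)\,N_2(q,n_2)/2.$$
   Context: An ordered graph is a graph on a linearly ordered vertex set. A monotone path of length $m$ in an ordered graph is a sequence of vertices $v_1<\dots<v_m$ with $v_iv_{i+1}$ an edge for all $i$. An ordered graph is $(q,m)$-path Ramsey if every coloring of its edges with $q$ colors contains a monochromatic monotone path of length $m$. $S_2(q,m)$ is the minimum number of edges of a $(q,m)$-path Ramsey ordered graph; $\chi(q,m)$ is the minimum chromatic number of a $(q,m)$-path Ramsey ordered graph; $N_2(q,m)$ is the smallest $N$ such that the complete graph on $[N]$ (with the natural order) is $(q,m)$-path Ramsey. *)

theory Defs
  imports Complex_Main "HOL-Library.Ramsey"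
begin

text \<open>Graphs are finite and simple: the edge set is a set of two-element subsets of the
  vertex set. The order is that of the ambient linearly ordered type.\<close>

definition ordered_graph :: "'a::linorder set \<Rightarrow> 'a set set \<Rightarrow> bool" where
  "ordered_graph V E \<longleftrightarrow> finite V \<and> E \<subseteq> [V]\<^bsup>2\<^esup>"

text \<open>The length of a monotone path is its number of vertices.\<close>

definition monotone_path :: "'a::linorder set \<Rightarrow> 'a set set \<Rightarrow> nat \<Rightarrow> 'a list \<Rightarrow> bool" where
  "monotone_path V E m vs \<longleftrightarrow>
     length vs = m \<and> set vs \<subseteq> V \<and> sorted_wrt (<) vs \<and>
     (\<forall>i. Suc i < m \<longrightarrow> {vs ! i, vs ! Suc i} \<in> E)"

definition path_Ramsey :: "nat \<Rightarrow> nat \<Rightarrow> 'a::linorder set \<Rightarrow> 'a set set \<Rightarrow> bool" where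
  "path_Ramsey q m V E \<longleftrightarrow>
     (\<forall>col \<in> E \<rightarrow> {..<q}. \<exists>vs. monotone_path V E m vs \<and>
        (\<exists>c<q. \<forall>i. Suc i < m \<longrightarrow> col {vs ! i, vs ! Suc i} = c))"

definition proper_coloring :: "'a set \<Rightarrow> 'a set set \<Rightarrow> nat \<Rightarrow> ('a \<Rightarrow> nat) \<Rightarrow> bool" where
  "proper_coloring V E k f \<longleftrightarrow>
     f \<in> V \<rightarrow> {..<k} \<and> (\<forall>u v. {u, v} \<in> E \<and> u \<noteq> v \<longrightarrow> f u \<noteq> f v)"

definition chromatic_number :: "'a set \<Rightarrow> 'a set set \<Rightarrow> nat" where
  "chromatic_number V E = (LEAST k. \<exists>f. proper_coloring V E k f)"

text \<open>Every finite linearly ordered set is order-isomorphic to a finite set of natural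
  numbers, so the minima below range over all finite ordered graphs up to isomorphism.\<close>

definition S\<^sub>2 :: "nat \<Rightarrow> nat \<Rightarrow> nat" where
  "S\<^sub>2 q m = (LEAST s. \<exists>(V::nat set) E. ordered_graph V E \<and> path_Ramsey q m V E \<and> s = card E)"

definition chi_Ramsey :: "nat \<Rightarrow> nat \<Rightarrow> nat" where
  "chi_Ramsey q m =
     (LEAST k. \<exists>(V::nat set) E. ordered_graph V E \<and> path_Ramsey q m V E \<and> k = chromatic_number V E)"

definition N\<^sub>2 :: "nat \<Rightarrow> nat \<Rightarrow> nat" where
  "N\<^sub>2 q m = (LEAST N. path_Ramsey q m {1..N} ([{1..N}]\<^bsup>2\<^esup>))"

end

theory Submission
  imports Defs
begin

text \<open>Put \<open>k = \<chi>(q, n1) - 1\<close> and split the vertices of a \<open>(q, n)\<close>-path Ramsey graph into the set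
  \<open>A\<close> of vertices of degree below \<open>k\<close> and its complement \<open>B\<close>. Greedy colouring shows that \<open>A\<close>
  induces a graph of chromatic number at most \<open>k\<close>, so its edges can be coloured without
  monochromatic monotone paths on \<open>n1\<close> vertices. If \<open>B\<close> had fewer than \<open>N\<^sub>2(q, n2)\<close> vertices, its
  edges could be coloured without such paths on \<open>n2\<close> vertices. Give the edges going up from
  \<open>A\<close> to \<open>B\<close> colour 0 and those going up from \<open>B\<close> to \<open>A\<close> colour 1: a monochromatic monotone
  path then changes sides at most once, so it has at most \<open>(n1 - 1) + (n2 - 1) < n\<close> vertices, a
  contradiction. Hence \<open>B\<close> has at least \<open>N\<^sub>2(q, n2)\<close> vertices, each of degree at least \<open>k\<close>.\<close>

text \<open>Order, adjacency and colour are merged into one relation, so that a monochromatic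
  monotone path becomes a list on which \<open>successively\<close> holds. Such lists can be cut and
  mapped without index arithmetic.\<close>

definition color_step :: "'a::linorder set set \<Rightarrow> ('a set \<Rightarrow> nat) \<Rightarrow> nat \<Rightarrow> 'a \<Rightarrow> 'a \<Rightarrow> bool" where
  "color_step E col c u v \<longleftrightarrow> u < v \<and> {u, v} \<in> E \<and> col {u, v} = c"

lemma monochromatic_path_iff_successively:
  "(monotone_path V E m vs \<and> (\<forall>i. Suc i < m \<longrightarrow> col {vs ! i, vs ! Suc i} = c)) \<longleftrightarrow>
     length vs = m \<and> set vs \<subseteq> V \<and> successively (color_step E col c) vs"
proof -
  have "sorted_wrt (<) vs \<longleftrightarrow> successively (<) vs"
    by (rule successively_conv_sorted_wrt[symmetric]) simp
  then show ?thesis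
    unfolding monotone_path_def successively_conv_nth color_step_def by auto
qed

lemma path_Ramsey_iff:
  "path_Ramsey q m V E \<longleftrightarrow>
     (\<forall>col \<in> E \<rightarrow> {..<q}. \<exists>c<q. \<exists>vs. length vs = m \<and> set vs \<subseteq> V \<and>
        successively (color_step E col c) vs)"
  unfolding path_Ramsey_def monochromatic_path_iff_successively[symmetric] by blast

text \<open>A path on more than \<open>m\<close> vertices has a prefix on exactly \<open>m\<close>,
  so a colouring that avoids length \<open>m\<close> bounds all monochromatic paths. Such strict
  bounds can be added when a path is cut in two.\<close>

lemma not_path_RamseyE:
  assumes "\<not> path_Ramsey q m V E"
  obtains col where "col \<in> E \<rightarrow> {..<q}"
    "\<And>c vs. c < q \<Longrightarrow> set vs \<subseteq> V \<Longrightarrow> successively (color_step E col c) vs \<Longrightarrow> length vs < m"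
proof -
  obtain col where col: "col \<in> E \<rightarrow> {..<q}"
    and no: "\<And>c vs. c < q \<Longrightarrow> length vs = m \<Longrightarrow> set vs \<subseteq> V \<Longrightarrow>
      \<not> successively (color_step E col c) vs"
    using assms unfolding path_Ramsey_iff by blast
  have "length vs < m" if "c < q" "set vs \<subseteq> V" "successively (color_step E col c) vs" for c vs
  proof (rule ccontr)
    assume "\<not> length vs < m"
    then have "length (take m vs) = m" by simp
    moreover have "set (take m vs) \<subseteq> V"
      using that(2) set_take_subset by fast
    moreover have "successively (color_step E col c) (take m vs)"
      using that(3) successively_append_iff[of _ "take m vs" "drop m vs"] by simp
    ultimately show False using no \<open>c < q\<close> by blast
  qed
  with col show thesis by (rule that)
qed

text \<open>A colouring of the target is pulled back along \<open>h\<close>. As \<open>h\<close>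
  preserves strict order and edges, it carries the monochromatic path found in the source over to
  the target.\<close>

lemma path_Ramsey_hom:
  fixes h :: "'a::linorder \<Rightarrow> 'b::linorder"
  assumes "path_Ramsey q m V E" and mono: "strict_mono_on V h" and "h ` V \<subseteq> W"
    and edges: "\<And>e. e \<in> E \<Longrightarrow> h ` e \<in> F"
  shows "path_Ramsey q m W F"
  unfolding path_Ramsey_iff
proof
  fix col assume col: "col \<in> F \<rightarrow> {..<q}"
  then have "(\<lambda>e. col (h ` e)) \<in> E \<rightarrow> {..<q}"
    using edges by fastforce
  then obtain c vs where "c < q" and vs: "length vs = m" "set vs \<subseteq> V"
    "successively (color_step E (\<lambda>e. col (h ` e)) c) vs"
    using assms(1) unfolding path_Ramsey_iff by blast
  have "successively (\<lambda>u v. color_step F col c (h u) (h v)) vs"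
    using vs(3)
  proof (rule successively_mono)
    fix u v assume "u \<in> set vs" "v \<in> set vs" "color_step E (\<lambda>e. col (h ` e)) c u v"
    then show "color_step F col c (h u) (h v)"
      using edges[of "{u, v}"] vs(2) strict_mono_onD[OF mono, of u v]
      unfolding color_step_def by auto
  qed
  then have "successively (color_step F col c) (map h vs)"
    by (simp add: successively_map)
  with \<open>c < q\<close> vs \<open>h ` V \<subseteq> W\<close>
  show "\<exists>c<q. \<exists>vs. length vs = m \<and> set vs \<subseteq> W \<and> successively (color_step F col c) vs"
    by (intro exI[of _ c] conjI exI[of _ "map h vs"]) auto
qed

lemma N\<^sub>2_le_card:
  fixes V :: "'a::linorder set"
  assumes "finite V" "E \<subseteq> [V]\<^bsup>2\<^esup>" "path_Ramsey q m V E"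
  shows "N\<^sub>2 q m \<le> card V"
proof -
  \<comment> \<open>The rank of \<open>x\<close> in \<open>V\<close>. Each vertex counts itself, so
    ranks start at 1, as do the vertices \<open>{1..N}\<close> in \<open>N\<^sub>2\<close>.\<close>
  define h where "h x = card {y \<in> V. y \<le> x}" for x
  have mono: "strict_mono_on V h"
  proof (rule strict_mono_onI)
    fix x y assume "x \<in> V" "y \<in> V" "x < y"
    then have "{z \<in> V. z \<le> x} \<subseteq> {z \<in> V. z \<le> y}" "y \<notin> {z \<in> V. z \<le> x}" "y \<in> {z \<in> V. z \<le> y}"
      by auto
    then show "h x < h y"
      unfolding h_def using \<open>finite V\<close> by (intro psubset_card_mono) auto
  qed
  have range: "h ` V \<subseteq> {1..card V}"
  proof -
    have "1 \<le> h x" if "x \<in> V" for x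
      using that \<open>finite V\<close> card_gt_0_iff[of "{y \<in> V. y \<le> x}"] by (auto simp: h_def Suc_le_eq)
    moreover have "h x \<le> card V" for x
      unfolding h_def using \<open>finite V\<close> by (intro card_mono) auto
    ultimately show ?thesis by auto
  qed
  have "h ` e \<in> [{1..card V}]\<^bsup>2\<^esup>" if "e \<in> E" for e
  proof -
    have e: "e \<subseteq> V" "finite e" "card e = 2"
      using that assms(2) by (auto simp: nsets_def)
    then have "inj_on h e"
      using strict_mono_on_imp_inj_on[OF mono] inj_on_subset by blast
    then show ?thesis
      using e range by (auto simp: nsets_def card_image)
  qed
  then have "path_Ramsey q m {1..card V} ([{1..card V}]\<^bsup>2\<^esup>)"
    using path_Ramsey_hom[OF assms(3) mono range] by blast
  then show ?thesis
    unfolding N\<^sub>2_def by (rule Least_le)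
qed

text \<open>This guarantees that the minimum in \<open>S\<^sub>2\<close> is attained. Ramsey's
  theorem gives a monochromatic clique on \<open>m\<close> vertices, and listing it in increasing
  order gives the path.\<close>

lemma ex_path_Ramsey_complete:
  "\<exists>N::nat. path_Ramsey q m {..<N} ([{..<N}]\<^bsup>2\<^esup>)"
proof -
  obtain N :: nat where N: "partn_lst {..<N} (replicate q m) 2"
    using ramsey_full by blast
  have "path_Ramsey q m {..<N} ([{..<N}]\<^bsup>2\<^esup>)"
    unfolding path_Ramsey_iff
  proof
    fix col :: "nat set \<Rightarrow> nat" assume "col \<in> [{..<N}]\<^bsup>2\<^esup> \<rightarrow> {..<q}"
    then obtain c H where "c < q" and H: "H \<in> [{..<N}]\<^bsup>m\<^esup>" "col ` [H]\<^bsup>2\<^esup> \<subseteq> {c}"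
      using N by (auto simp: partn_lst_def monochromatic_def)
    define vs where "vs = sorted_list_of_set H"
    have fin: "finite H" "card H = m" "H \<subseteq> {..<N}"
      using H(1) by (auto simp: nsets_def)
    have "successively (<) vs"
      unfolding vs_def by (rule successively_if_sorted_wrt) simp
    then have "successively (color_step ([{..<N}]\<^bsup>2\<^esup>) col c) vs"
    proof (rule successively_mono)
      fix u v assume "u \<in> set vs" "v \<in> set vs" "u < v"
      then have "{u, v} \<in> [H]\<^bsup>2\<^esup>"
        using fin by (auto simp: vs_def nsets_def)
      moreover have "[H]\<^bsup>2\<^esup> \<subseteq> [{..<N}]\<^bsup>2\<^esup>"
        using fin by (intro nsets_mono)
      ultimately show "color_step ([{..<N}]\<^bsup>2\<^esup>) col c u v"
        using H(2) \<open>u < v\<close> unfolding color_step_def by blast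
    qed
    with \<open>c < q\<close> fin
    show "\<exists>c<q. \<exists>vs. length vs = m \<and> set vs \<subseteq> {..<N} \<and>
        successively (color_step ([{..<N}]\<^bsup>2\<^esup>) col c) vs"
      by (intro exI[of _ c] conjI exI[of _ vs]) (auto simp: vs_def)
  qed
  then show ?thesis ..
qed

text \<open>Greedy colouring. Degrees are counted in all of \<open>E\<close>, not in the graph
  induced on \<open>S\<close>, so the hypothesis passes unchanged to subsets in the
  induction.\<close>

lemma ex_proper_coloring_if_degree_less:
  assumes "finite S" "finite E" "\<And>v. v \<in> S \<Longrightarrow> card {e \<in> E. v \<in> e} < k"
  shows "\<exists>f. proper_coloring S {e \<in> E. e \<subseteq> S} k f"
  using assms(1,3)
proof (induction S)
  case empty
  then show ?case by (auto simp: proper_coloring_def)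
next
  case (insert a S)
  then obtain f where f: "proper_coloring S {e \<in> E. e \<subseteq> S} k f" by blast
  define Nb where "Nb = {u \<in> S. {a, u} \<in> E}"
  have "finite Nb" using insert.hyps by (simp add: Nb_def)
  \<comment> \<open>Distinct neighbours of \<open>a\<close> give distinct edges at \<open>a\<close>,
    so fewer than \<open>k\<close> colours are blocked.\<close>
  have "inj_on (\<lambda>u. {a, u}) Nb"
    by (auto simp: inj_on_def doubleton_eq_iff)
  then have "card Nb \<le> card {e \<in> E. a \<in> e}"
    using \<open>finite E\<close> by (intro card_inj_on_le) (auto simp: Nb_def)
  then have "card (f ` Nb) < k"
    using insert.prems[of a] card_image_le[OF \<open>finite Nb\<close>, of f] by simp
  then have "\<not> {..<k} \<subseteq> f ` Nb"
    using card_mono[of "f ` Nb" "{..<k}"] \<open>finite Nb\<close> by auto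
  then obtain c where "c < k" "c \<notin> f ` Nb" by auto
  then have "proper_coloring (insert a S) {e \<in> E. e \<subseteq> insert a S} k (f(a := c))"
    using f \<open>a \<notin> S\<close> unfolding proper_coloring_def Nb_def
    by (auto simp: insert_commute)
  then show ?case by blast
qed

lemma sum_degree_eq_twice_card_edges:
  assumes "finite V" "E \<subseteq> [V]\<^bsup>2\<^esup>"
  shows "(\<Sum>v\<in>V. card {e \<in> E. v \<in> e}) = 2 * card E"
proof (rule sum_multicount)
  show "finite V" by fact
  show "finite E" using assms finite_imp_finite_nsets finite_subset by blast
  show "\<forall>e\<in>E. card {v \<in> V. v \<in> e} = 2"
  proof
    fix e assume "e \<in> E"
    then have "{v \<in> V. v \<in> e} = e" "card e = 2"
      using assms(2) by (auto simp: nsets_def)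
    then show "card {v \<in> V. v \<in> e} = 2" by simp
  qed
qed

text \<open>No step enters \<open>A\<close> from outside, so a path that has left \<open>A\<close>
  never returns.\<close>

lemma successively_split_closed:
  assumes "successively R vs"
    and "\<And>u v. u \<in> set vs \<Longrightarrow> v \<in> set vs \<Longrightarrow> R u v \<Longrightarrow> v \<in> A \<Longrightarrow> u \<in> A"
  obtains xs ys where "vs = xs @ ys" "set xs \<subseteq> A" "set ys \<inter> A = {}"
    "successively R xs" "successively R ys"
proof -
  have "\<exists>xs ys. vs = xs @ ys \<and> set xs \<subseteq> A \<and> set ys \<inter> A = {}"
    using assms
  proof (induction vs)
    case (Cons v vs)
    then obtain xs ys where xs: "vs = xs @ ys" "set xs \<subseteq> A" "set ys \<inter> A = {}"
      by (auto simp: successively_Cons)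
    show ?case
    proof (cases "v \<in> A")
      case True
      then show ?thesis using xs by (intro exI[of _ "v # xs"] exI[of _ ys]) auto
    next
      case False
      \<comment> \<open>Otherwise the step out of \<open>v\<close> would enter \<open>A\<close> from
        outside.\<close>
      have "xs = []"
      proof (rule ccontr)
        assume "xs \<noteq> []"
        then have "hd vs \<in> A" "R v (hd vs)" "hd vs \<in> set vs"
          using xs Cons.prems(1) by (auto simp: successively_Cons hd_append)
        then show False using Cons.prems(2)[of v "hd vs"] False by auto
      qed
      then show ?thesis using xs False by (intro exI[of _ "[]"] exI[of _ "v # vs"]) auto
    qed
  qed simp
  then show thesis
    using that assms(1) by (metis successively_append_iff)
qed

lemma not_path_Ramsey_union:
  fixes A B :: "'a::linorder set"
  assumes "A \<inter> B = {}" and "q \<ge> 2" and "n1 \<ge> 1" and "n2 \<ge> 1"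
    and "\<not> path_Ramsey q n1 A {e \<in> E. e \<subseteq> A}"
    and "\<not> path_Ramsey q n2 B {e \<in> E. e \<subseteq> B}"
  shows "\<not> path_Ramsey q (n1 + n2 - 1) (A \<union> B) E"
proof -
  let ?EA = "{e \<in> E. e \<subseteq> A}" and ?EB = "{e \<in> E. e \<subseteq> B}"
  obtain colA where colA: "colA \<in> ?EA \<rightarrow> {..<q}"
    and pathA: "\<And>c vs. c < q \<Longrightarrow> set vs \<subseteq> A \<Longrightarrow> successively (color_step ?EA colA c) vs \<Longrightarrow>
      length vs < n1"
    using not_path_RamseyE[OF assms(5)] by blast
  obtain colB where colB: "colB \<in> ?EB \<rightarrow> {..<q}"
    and pathB: "\<And>c vs. c < q \<Longrightarrow> set vs \<subseteq> B \<Longrightarrow> successively (color_step ?EB colB c) vs \<Longrightarrow>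
      length vs < n2"
    using not_path_RamseyE[OF assms(6)] by blast
  \<comment> \<open>The default 1 also catches edges that leave the union of \<open>A\<close> and
    \<open>B\<close>; no path considered here uses them. Both 0 and 1 are legal colours because
    \<open>q\<close> is at least 2.\<close>
  define col where "col e = (if e \<subseteq> A then colA e else if e \<subseteq> B then colB e
    else if \<exists>u\<in>A. \<exists>v\<in>B. e = {u, v} \<and> u < v then 0 else 1)" for e
  have lenA: "length vs < n1"
    if "c < q" "set vs \<subseteq> A" "successively (color_step E col c) vs" for c vs
  proof (rule pathA[OF that(1,2)], rule successively_mono[OF that(3)])
    fix u v assume "u \<in> set vs" "v \<in> set vs" "color_step E col c u v"
    then show "color_step ?EA colA c u v"
      using that(2) by (auto simp: color_step_def col_def split: if_splits)
  qed
  have lenB: "length vs < n2"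
    if "c < q" "set vs \<subseteq> B" "successively (color_step E col c) vs" for c vs
  proof (rule pathB[OF that(1,2)], rule successively_mono[OF that(3)])
    fix u v assume "u \<in> set vs" "v \<in> set vs" "color_step E col c u v"
    then have "u \<in> B" "v \<in> B" "u \<notin> A" "v \<notin> A"
      using that(2) assms(1) by auto
    with \<open>color_step E col c u v\<close> show "color_step ?EB colB c u v"
      by (auto simp: color_step_def col_def)
  qed
  have upAB: "c = 0" if "color_step E col c u v" "u \<in> A" "v \<in> B" for c u v
    using that assms(1) by (auto simp: color_step_def col_def)
  have upBA: "c = 1" if "color_step E col c u v" "u \<in> B" "v \<in> A" for c u v
    using that assms(1) by (auto simp: color_step_def col_def doubleton_eq_iff)
  have "col \<in> E \<rightarrow> {..<q}"
    using colA colB assms(2) by (auto simp: col_def)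
  moreover have "length vs < n1 + n2 - 1"
    if "c < q" and sub: "set vs \<subseteq> A \<union> B" and vs: "successively (color_step E col c) vs" for c vs
  proof (cases "c = 0")
    case True
    \<comment> \<open>Colour 0 never crosses upwards from \<open>B\<close> to \<open>A\<close>, so
      the part in \<open>A\<close> comes first.\<close>
    then have "u \<in> A" if "u \<in> set vs" "v \<in> set vs" "color_step E col c u v" "v \<in> A" for u v
      using upBA[of c u v] that sub by auto
    from successively_split_closed[OF vs this] obtain xs ys
      where "vs = xs @ ys" "set xs \<subseteq> A" "set ys \<inter> A = {}"
        "successively (color_step E col c) xs" "successively (color_step E col c) ys" .
    moreover from this have "set ys \<subseteq> B" using sub by auto
    ultimately show ?thesis
      using lenA[of c xs] lenB[of c ys] \<open>c < q\<close> by simp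
  next
    case False
    \<comment> \<open>Every other colour, not only 1, lacks upward crossings from \<open>A\<close>
      to \<open>B\<close>, so the part in \<open>B\<close> comes first.\<close>
    then have "u \<in> B" if "u \<in> set vs" "v \<in> set vs" "color_step E col c u v" "v \<in> B" for u v
      using upAB[of c u v] that sub by auto
    from successively_split_closed[OF vs this] obtain xs ys
      where "vs = xs @ ys" "set xs \<subseteq> B" "set ys \<inter> B = {}"
        "successively (color_step E col c) xs" "successively (color_step E col c) ys" .
    moreover from this have "set ys \<subseteq> A" using sub by auto
    ultimately show ?thesis
      using lenB[of c xs] lenA[of c ys] \<open>c < q\<close> by simp
  qed
  ultimately show ?thesis
    unfolding path_Ramsey_iff by (metis less_irrefl)
qed

lemma path_Ramsey_card_edges_ge:
  fixes V :: "nat set"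
  assumes "ordered_graph V E" "path_Ramsey q (n1 + n2 - 1) V E"
    and "q \<ge> 2" "n1 \<ge> 1" "n2 \<ge> 1"
  shows "(chi_Ramsey q n1 - 1) * N\<^sub>2 q n2 \<le> 2 * card E"
proof (cases "chi_Ramsey q n1 = 0")
  case False
  \<comment> \<open>Subtraction is truncated: \<open>k\<close> lies strictly below
    \<open>chi_Ramsey q n1\<close> only because the latter is nonzero here.\<close>
  define k where "k = chi_Ramsey q n1 - 1"
  have finV: "finite V" and E: "E \<subseteq> [V]\<^bsup>2\<^esup>"
    using assms(1) by (auto simp: ordered_graph_def)
  have finE: "finite E"
    using finV E finite_imp_finite_nsets finite_subset by blast
  define A where "A = {v \<in> V. card {e \<in> E. v \<in> e} < k}"
  define B where "B = V - A"
  have fin: "finite A" "finite B" using finV by (auto simp: A_def B_def)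
  have "\<exists>f. proper_coloring A {e \<in> E. e \<subseteq> A} k f"
    by (rule ex_proper_coloring_if_degree_less[OF fin(1) finE]) (simp add: A_def)
  then have "chromatic_number A {e \<in> E. e \<subseteq> A} \<le> k"
    unfolding chromatic_number_def by (rule Least_le)
  also have "k < chi_Ramsey q n1" using False by (simp add: k_def)
  \<comment> \<open>By minimality, a graph of chromatic number below \<open>chi_Ramsey q n1\<close>
    is not path Ramsey for \<open>n1\<close>.\<close>
  finally have "\<not> (\<exists>(V'::nat set) E'. ordered_graph V' E' \<and> path_Ramsey q n1 V' E' \<and>
      chromatic_number A {e \<in> E. e \<subseteq> A} = chromatic_number V' E')"
    unfolding chi_Ramsey_def by (rule not_less_Least)
  moreover have "ordered_graph A {e \<in> E. e \<subseteq> A}"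
    using fin(1) E by (auto simp: ordered_graph_def nsets_def)
  ultimately have notA: "\<not> path_Ramsey q n1 A {e \<in> E. e \<subseteq> A}" by blast
  have "A \<union> B = V" "A \<inter> B = {}" by (auto simp: A_def B_def)
  then have "path_Ramsey q n2 B {e \<in> E. e \<subseteq> B}"
    using not_path_Ramsey_union[OF _ assms(3-5) notA] assms(2) by metis
  moreover have "{e \<in> E. e \<subseteq> B} \<subseteq> [B]\<^bsup>2\<^esup>"
    using E by (auto simp: nsets_def)
  ultimately have "N\<^sub>2 q n2 \<le> card B"
    using N\<^sub>2_le_card[OF fin(2)] by blast
  \<comment> \<open>Double counting: vertices in \<open>B\<close> have degree at least
    \<open>k\<close> by the choice of \<open>A\<close>, and the degrees over all of \<open>V\<close>
    sum to twice the number of edges.\<close>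
  then have "k * N\<^sub>2 q n2 \<le> (\<Sum>v\<in>B. k)" by simp
  also have "\<dots> \<le> (\<Sum>v\<in>B. card {e \<in> E. v \<in> e})"
    by (rule sum_mono) (auto simp: A_def B_def)
  also have "\<dots> \<le> (\<Sum>v\<in>V. card {e \<in> E. v \<in> e})"
    using finV by (intro sum_mono2) (auto simp: B_def)
  also have "\<dots> = 2 * card E"
    by (rule sum_degree_eq_twice_card_edges[OF finV E])
  finally show ?thesis by (simp add: k_def)
qed simp

theorem theorem12:
  fixes n1 n2 q n :: nat
  assumes "n1 \<ge> 2" and "n2 \<ge> 2" and "q \<ge> 2" and "n = n1 + n2 - 1"
  shows "real (S\<^sub>2 q n) \<ge> (real (chi_Ramsey q n1) - 1) * real (N\<^sub>2 q n2) / 2"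
proof -
  obtain N :: nat where "path_Ramsey q n {..<N} ([{..<N}]\<^bsup>2\<^esup>)"
    using ex_path_Ramsey_complete by blast
  then have "\<exists>s (V::nat set) E. ordered_graph V E \<and> path_Ramsey q n V E \<and> s = card E"
    by (auto simp: ordered_graph_def)
  then have "\<exists>(V::nat set) E. ordered_graph V E \<and> path_Ramsey q n V E \<and> S\<^sub>2 q n = card E"
    unfolding S\<^sub>2_def by (rule LeastI_ex)
  then obtain V :: "nat set" and E
    where "ordered_graph V E" "path_Ramsey q n V E" "S\<^sub>2 q n = card E" by blast
  then have "(chi_Ramsey q n1 - 1) * N\<^sub>2 q n2 \<le> 2 * S\<^sub>2 q n"
    using path_Ramsey_card_edges_ge[of V E q n1 n2] assms by simp
  then have "real (chi_Ramsey q n1 - 1) * real (N\<^sub>2 q n2) \<le> 2 * real (S\<^sub>2 q n)"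
    by (metis of_nat_le_iff of_nat_mult of_nat_numeral)
  \<comment> \<open>Real subtraction never exceeds truncated subtraction, so the bound over the
    naturals suffices.\<close>
  moreover have "(real (chi_Ramsey q n1) - 1) * real (N\<^sub>2 q n2)
      \<le> real (chi_Ramsey q n1 - 1) * real (N\<^sub>2 q n2)"
    by (intro mult_right_mono) auto
  ultimately show ?thesis by simp
qed

end
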